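(* Let $p,q\ge 0$ be integers, let $z,a_1,\dots,a_p,b_1,\dots,b_q\in\mathbb{C}$, and put $$\lambda(x)=z(x+a_1)\cdots(x+a_p),\qquad \phi(x)=x(x+b_1)\cdots(x+b_q).$$ Let $L:\mathbb{C}[x]\to\mathbb{C}$ be a linear functional satisfying $L[\lambda(x)\pi(x)]=L[\phi(x)\pi(x-1)]$ for all $\pi\in\mathbb{C}[x]$, and let $\{P_n\}_{n\ge0}$ be the sequence of monic orthogonal polynomials with respect to $L$ (assumed to exist), with three-term recurrence $$xP_n(x)=P_{n+1}(x)+\beta_nP_n(x)+\gamma_nP_{n-1}(x),\qquad n\ge 0,\quad \gamma_0=0.$$ For $n\ge0$ let $A_k(n)$, $k\in\mathbb{Z}$, be the coefficients in the expansion $$\lambda(x)P_n(x+1)=\sum_{k}A_k(n)P_{n+k}(x).$$ Then for all $n\ge0$ and all integers $k$ with $-q-1\le k\le p$, $$\gamma_{n+k+1}A_{k+1}(n)-\gamma_nA_{k+1}(n-1)+A_{k-1}(n)-A_{k-1}(n+1)=(\beta_n-\beta_{n+k}-1)A_k(n),$$ where, for all $n\ge0$, $$A_p(n)=z,\qquad A_{-q-1}(n)=\gamma_n\gamma_{n-1}\cdots\gamma_{n-q},\qquad A_{p+1}(n)=0=A_{-q-2}(n).$$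
   Context: A sequence of monic polynomials $P_n\in\mathbb{C}[x]$ with $\deg P_n=n$, $n=0,1,\dots$, is orthogonal with respect to a linear functional $L$ if $L[P_nP_m]=h_n\delta_{n,m}$ for all $n,m\ge0$, with $h_n\ne0$. The recurrence coefficients are $\beta_n=L[xP_n^2]/h_n$ for $n\ge 0$ and $\gamma_n=L[xP_nP_{n-1}]/h_{n-1}=h_n/h_{n-1}$ for $n\ge1$, and $\gamma_0=0$. Conventions for negative indices: $P_m=0$, $\gamma_m=0$, $\beta_m=0$ for $m<0$; $A_k(n)=0$ whenever $n<0$ or $n+k<0$. With these conventions the coefficients $A_k(n)$ are uniquely determined. *)

theory Defs
  imports Complex_Main "HOL-Computational_Algebra.Polynomial"
begin

definition linear_functional :: "(complex poly \<Rightarrow> complex) \<Rightarrow> bool" where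
  "linear_functional L \<longleftrightarrow> Vector_Spaces.linear smult (*) L"

definition monic_OPS :: "(complex poly \<Rightarrow> complex) \<Rightarrow> (nat \<Rightarrow> complex poly) \<Rightarrow> bool" where
  "monic_OPS L P \<longleftrightarrow>
     (\<forall>n. degree (P n) = n \<and> lead_coeff (P n) = 1) \<and>
     (\<exists>h :: nat \<Rightarrow> complex. (\<forall>n. h n \<noteq> 0) \<and>
        (\<forall>n m. L (P n * P m) = (if n = m then h n else 0)))"

text \<open>All sequences are extended to integer indices, with value zero at negative indices.\<close>

definition ops_ext :: "(nat \<Rightarrow> complex poly) \<Rightarrow> int \<Rightarrow> complex poly" where
  "ops_ext P m = (if m < 0 then 0 else P (nat m))"

definition rec_beta :: "(complex poly \<Rightarrow> complex) \<Rightarrow> (nat \<Rightarrow> complex poly) \<Rightarrow> int \<Rightarrow> complex" where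
  "rec_beta L P m = (if m < 0 then 0
     else L ([:0, 1:] * (P (nat m))\<^sup>2) / L ((P (nat m))\<^sup>2))"

definition rec_gamma :: "(complex poly \<Rightarrow> complex) \<Rightarrow> (nat \<Rightarrow> complex poly) \<Rightarrow> int \<Rightarrow> complex" where
  "rec_gamma L P m = (if m \<le> 0 then 0
     else L ([:0, 1:] * P (nat m) * P (nat m - 1)) / L ((P (nat m - 1))\<^sup>2))"

definition pearson_lambda :: "complex \<Rightarrow> nat \<Rightarrow> (nat \<Rightarrow> complex) \<Rightarrow> complex poly" where
  "pearson_lambda z p a = smult z (\<Prod>i=1..p. [:a i, 1:])"

definition pearson_phi :: "nat \<Rightarrow> (nat \<Rightarrow> complex) \<Rightarrow> complex poly" where
  "pearson_phi q b = [:0, 1:] * (\<Prod>i=1..q. [:b i, 1:])"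

text \<open>\<open>A k n\<close> is the coefficient of \<open>P\<^sub>n\<^sub>+\<^sub>k\<close> in the expansion of \<open>\<lambda>(x) P\<^sub>n(x + 1)\<close>.\<close>

definition shift_coeffs ::
    "complex poly \<Rightarrow> (nat \<Rightarrow> complex poly) \<Rightarrow> (int \<Rightarrow> int \<Rightarrow> complex) \<Rightarrow> bool" where
  "shift_coeffs lam P A \<longleftrightarrow>
     (\<forall>k n. n < 0 \<or> n + k < 0 \<longrightarrow> A k n = 0) \<and>
     (\<forall>n\<ge>0. finite {k. A k n \<noteq> 0} \<and>
        lam * pcompose (ops_ext P n) [:1, 1:] =
          (\<Sum>k | A k n \<noteq> 0. smult (A k n) (ops_ext P (n + k))))"

text \<open>The three-term recurrence is a consequence of the definitions above.\<close>

lemma linear_functional_simps: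
  assumes "linear_functional L"
  shows "L (f + g) = L f + L g" "L (f - g) = L f - L g" "L (smult c f) = c * L f" "L 0 = 0"
proof -
  interpret Vector_Spaces.linear smult "(*)" L
    using assms by (simp add: linear_functional_def)
  show "L (f + g) = L f + L g" by (rule add)
  show "L (f - g) = L f - L g" by (rule diff)
  show "L (smult c f) = c * L f" by (rule scale)
  show "L 0 = 0" by (rule zero)
qed

lemma monic_OPS_D:
  assumes "monic_OPS L P"
  shows "degree (P n) = n" "coeff (P n) n = 1" "L ((P n)\<^sup>2) \<noteq> 0"
    "n \<noteq> m \<Longrightarrow> L (P n * P m) = 0"
proof -
  show "degree (P n) = n" and "coeff (P n) n = 1"
    using assms unfolding monic_OPS_def by metis+
  obtain h where h: "\<And>n. h n \<noteq> 0" "\<And>n m. L (P n * P m) = (if n = m then h n else 0)"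
    using assms unfolding monic_OPS_def by blast
  show "L ((P n)\<^sup>2) \<noteq> 0" using h by (simp add: power2_eq_square)
  show "n \<noteq> m \<Longrightarrow> L (P n * P m) = 0" using h by simp
qed

lemma degree_diff_monic:
  fixes f :: "complex poly"
  assumes "monic_OPS L P" "degree f \<le> Suc m"
  shows "degree (f - smult (coeff f (Suc m)) (P (Suc m))) \<le> m"
proof (rule degree_le, intro allI impI)
  fix i assume "m < i"
  show "coeff (f - smult (coeff f (Suc m)) (P (Suc m))) i = 0"
  proof (cases "i = Suc m")
    case True
    then show ?thesis using monic_OPS_D(2)[OF assms(1), of "Suc m"] by simp
  next
    case False
    then have "i > Suc m" using \<open>m < i\<close> by simp
    then show ?thesis
      using assms(2) monic_OPS_D(1)[OF assms(1), of "Suc m"] by (simp add: coeff_eq_0)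
  qed
qed

lemma degree_0_monic:
  assumes "monic_OPS L P" "degree f = 0"
  shows "f = smult (coeff f 0) (P 0)"
proof -
  obtain c where c: "P 0 = [:c:]"
    using monic_OPS_D(1)[OF assms(1), of 0] by (auto elim: degree_eq_zeroE)
  then have "c = 1" using monic_OPS_D(2)[OF assms(1), of 0] by simp
  moreover obtain d where "f = [:d:]" using assms(2) by (auto elim: degree_eq_zeroE)
  ultimately show ?thesis using c by simp
qed

lemma ops_orthogonal_lower:
  assumes "linear_functional L" "monic_OPS L P"
  shows "degree f \<le> m \<Longrightarrow> m < n \<Longrightarrow> L (P n * f) = 0"
proof (induction m arbitrary: f)
  case 0
  then have f: "f = smult (coeff f 0) (P 0)" using degree_0_monic[OF assms(2)] by simp
  show ?case
    by (subst f) (use 0 in \<open>simp add: linear_functional_simps[OF assms(1)] monic_OPS_D(4)[OF assms(2)]\<close>)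
next
  case (Suc m)
  let ?g = "smult (coeff f (Suc m)) (P (Suc m))"
  have "L (P n * (f - ?g)) = 0"
    using Suc degree_diff_monic[OF assms(2)] by simp
  moreover have "L (P n * ?g) = 0"
    using Suc.prems by (simp add: linear_functional_simps[OF assms(1)] monic_OPS_D(4)[OF assms(2)])
  ultimately show ?case
    by (simp add: right_diff_distrib linear_functional_simps[OF assms(1)])
qed

lemma ops_complete:
  assumes "linear_functional L" "monic_OPS L P"
  shows "degree f \<le> m \<Longrightarrow> (\<And>k. k \<le> m \<Longrightarrow> L (P k * f) = 0) \<Longrightarrow> f = 0"
proof (induction m arbitrary: f)
  case 0
  then have f: "f = smult (coeff f 0) (P 0)" using degree_0_monic[OF assms(2)] by simp
  have "L (P 0 * f) = coeff f 0 * L ((P 0)\<^sup>2)"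
    by (subst f) (simp add: linear_functional_simps[OF assms(1)] power2_eq_square)
  then have "coeff f 0 = 0" using 0 monic_OPS_D(3)[OF assms(2), of 0] by simp
  then show ?case using f by simp
next
  case (Suc m)
  let ?c = "coeff f (Suc m)"
  have "L (P (Suc m) * (f - smult ?c (P (Suc m)))) = 0"
    using ops_orthogonal_lower[OF assms] degree_diff_monic[OF assms(2) Suc.prems(1)] by blast
  then have "?c * L ((P (Suc m))\<^sup>2) = 0"
    using Suc.prems(2)[of "Suc m"]
    by (simp add: right_diff_distrib linear_functional_simps[OF assms(1)] power2_eq_square)
  then have "?c = 0" using monic_OPS_D(3)[OF assms(2)] by simp
  then have "degree f \<le> m"
    using degree_diff_monic[OF assms(2) Suc.prems(1)] by simp
  then show ?case using Suc by simp
qed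

lemma three_term_recurrence:
  assumes L: "linear_functional L" and P: "monic_OPS L P"
  shows "[:0, 1:] * P n =
    P (Suc n) + smult (rec_beta L P (int n)) (P n)
      + smult (rec_gamma L P (int n)) (ops_ext P (int n - 1))"
proof -
  note lin = linear_functional_simps[OF L]
  note ops = monic_OPS_D[OF P]
  let ?X = "[:0, 1:] :: complex poly"
  let ?b = "rec_beta L P (int n)" and ?c = "rec_gamma L P (int n)"
  let ?Q = "ops_ext P (int n - 1)"
  let ?f = "?X * P n - P (Suc n) - smult ?b (P n) - smult ?c ?Q"
  have Q: "n = 0 \<and> ?Q = 0 \<and> ?c = 0 \<or> (\<exists>m. n = Suc m \<and> ?Q = P m)"
    by (cases n) (auto simp: ops_ext_def rec_gamma_def)
  have deg: "degree ?f \<le> n"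
  proof (rule degree_le, intro allI impI)
    fix i assume i: "n < i"
    have *: "coeff (P n) i = 0" "coeff ?Q i = 0" "coeff (?X * P n) i = coeff (P (Suc n)) i"
    proof -
      show "coeff (P n) i = 0" using i ops(1) by (simp add: coeff_eq_0)
      show "coeff ?Q i = 0" using i Q ops(1) by (auto simp: coeff_eq_0)
      obtain j where j: "i = Suc j" using i by (cases i) auto
      show "coeff (?X * P n) i = coeff (P (Suc n)) i"
      proof (cases "j = n")
        case True
        then show ?thesis using j ops(2) by simp
      next
        case False
        then show ?thesis using i j ops(1) by (simp add: coeff_eq_0)
      qed
    qed
    then show "coeff ?f i = 0" by (simp del: mult_pCons_left)
  qed
  have "L (P k * ?f) = 0" if "k \<le> n" for k
  proof -
    have e: "L (P k * ?f) = L (P k * (?X * P n)) - ?b * L (P k * P n) - ?c * L (P k * ?Q)"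
      using that by (simp add: right_diff_distrib lin ops(4) del: mult_pCons_left)
    consider "k = n" | m where "n = Suc m" "k = m" | m where "n = Suc m" "k < m"
      using \<open>k \<le> n\<close> by (cases n) (auto simp: le_less less_Suc_eq)
    then show ?thesis
    proof cases
      case 1
      have "L (P k * ?Q) = 0 \<or> ?c = 0" using Q 1 ops(4) by auto
      moreover have "L (P n * (?X * P n)) = ?b * L (P n * P n)"
        using ops(3)[of n]
        by (simp add: rec_beta_def power2_eq_square mult.left_commute del: mult_pCons_left)
      ultimately show ?thesis using e 1 by auto
    next
      case 2
      have "?Q = P m" using 2 by (simp add: ops_ext_def)
      moreover have "L (P m * (?X * P n)) = ?c * L (P m * P m)"
        using ops(3)[of m] 2
        by (simp add: rec_gamma_def power2_eq_square ac_simps nat_add_distrib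
            del: mult_pCons_left mult_pCons_right)
      ultimately show ?thesis using e 2 ops(4)[of m n] by simp
    next
      case 3
      have Q': "?Q = P m" using 3 by (simp add: ops_ext_def)
      have "degree (?X * P k) \<le> Suc k"
        using ops(1)[of k] degree_mult_le[of ?X "P k"] by simp
      then have "L (P n * (?X * P k)) = 0"
        using 3 by (intro ops_orthogonal_lower[OF L P]) auto
      then have "L (P k * (?X * P n)) = 0" by (simp add: ac_simps del: mult_pCons_left mult_pCons_right)
      then show ?thesis using e Q' 3 ops(4)[of k n] ops(4)[of k m] by simp
    qed
  qed
  then have "?f = 0" using ops_complete[OF L P deg] by blast
  then show ?thesis by (simp add: algebra_simps del: mult_pCons_left)
qed

end

theory Submission
  imports Defs
begin

text \<open>Orthogonality gives \<open>A\<^sub>k(n) h\<^sub>n\<^sub>+\<^sub>k = L[\<lambda>(x) P\<^sub>n(x+1) P\<^sub>n\<^sub>+\<^sub>k(x)]\<close>. Computing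
  \<open>L[x \<lambda>(x) P\<^sub>n(x+1) P\<^sub>n\<^sub>+\<^sub>k(x)]\<close> in two ways, with the three-term recurrence applied to the factor
  \<open>P\<^sub>n\<^sub>+\<^sub>k(x)\<close> or to \<open>P\<^sub>n(x+1)\<close>, yields the difference equation. The boundary values for
  \<open>k \<ge> p\<close> follow by comparing degrees; those for \<open>k < -q\<close> likewise, after the Pearson equation has
  turned the functional into \<open>L[\<phi>(x) P\<^sub>n(x) P\<^sub>n\<^sub>+\<^sub>k(x-1)]\<close>.\<close>

section \<open>Degrees and extreme coefficients of products, shifts and the Pearson
  polynomials\<close>

lemma linear_functional_sum:
  assumes "linear_functional L"
  shows "L (\<Sum>i\<in>I. f i) = (\<Sum>i\<in>I. L (f i))"
proof -
  interpret Vector_Spaces.linear smult "(*)" L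
    using assms by (simp add: linear_functional_def)
  show ?thesis by (rule sum)
qed

text \<open>Upper bounds on the degrees suffice: when one of them is not attained, both sides
  vanish. This matters because \<open>z = 0\<close> is allowed, so
  \<open>pearson_lambda z p a\<close> may have degree below \<open>p\<close>.\<close>

lemma coeff_mult_degree_le:
  fixes f g :: "complex poly"
  assumes "degree f \<le> m" "degree g \<le> n"
  shows "coeff (f * g) (m + n) = coeff f m * coeff g n"
proof (cases "degree f = m \<and> degree g = n")
  case True
  then show ?thesis using coeff_mult_degree_sum[of f g] by simp
next
  case False
  then have less: "degree f < m \<or> degree g < n" using assms by (auto simp: le_less)
  then have "degree f + degree g < m + n"
    using assms by (auto intro: add_less_le_mono add_le_less_mono)
  then have "coeff (f * g) (m + n) = 0"
    by (intro coeff_eq_0 le_less_trans[OF degree_mult_le])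
  with less show ?thesis by (auto simp: coeff_eq_0)
qed

lemma degree_coeff_prod_monic_linear:
  fixes a :: "'i \<Rightarrow> complex"
  shows "degree (\<Prod>i\<in>I. [:a i, 1:]) = card I" "lead_coeff (\<Prod>i\<in>I. [:a i, 1:]) = 1"
proof -
  show "degree (\<Prod>i\<in>I. [:a i, 1:]) = card I"
    by (subst degree_prod_eq_sum_degree) auto
  show "lead_coeff (\<Prod>i\<in>I. [:a i, 1:]) = 1"
    by (simp add: lead_coeff_prod)
qed

lemma degree_pearson_lambda: "degree (pearson_lambda z p a) \<le> p"
  and coeff_pearson_lambda: "coeff (pearson_lambda z p a) p = z"
  using degree_coeff_prod_monic_linear[of a "{1..p}"] degree_smult_le[of z "\<Prod>i=1..p. [:a i, 1:]"]
  by (simp_all only: pearson_lambda_def coeff_smult card_atLeastAtMost diff_Suc_1 mult_1_right)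

lemma degree_pearson_phi: "degree (pearson_phi q b) \<le> Suc q"
  and coeff_pearson_phi: "coeff (pearson_phi q b) (Suc q) = 1"
proof -
  have phi: "pearson_phi q b = pCons 0 (\<Prod>i=1..q. [:b i, 1:])"
    by (simp add: pearson_phi_def)
  show "degree (pearson_phi q b) \<le> Suc q" and "coeff (pearson_phi q b) (Suc q) = 1"
    unfolding phi
    using degree_coeff_prod_monic_linear[of b "{1..q}"] degree_pCons_le[of 0 "\<Prod>i=1..q. [:b i, 1:]"]
    by (simp_all only: coeff_pCons_Suc card_atLeastAtMost diff_Suc_1)
qed

lemma coeff_pcompose_shift_degree:
  "coeff (pcompose f [:c, 1:]) (degree f) = lead_coeff (f :: complex poly)"
  using lead_coeff_comp[of "[:c, 1:]" f] by (simp add: degree_pcompose)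

lemma pcompose_shift_inverse:
  "pcompose (pcompose f [:1, 1:]) [:-1, 1:] = (f :: complex poly)"
  by (simp flip: pcompose_assoc add: pcompose_pCons)

section \<open>Orthogonality and square norms for integer indices\<close>

lemma ops_ext_negative [simp]: "n < 0 \<Longrightarrow> ops_ext P n = 0"
  by (simp add: ops_ext_def)

lemma square_norm_nonzero:
  assumes ops: "monic_OPS L P"
  shows "n \<ge> 0 \<Longrightarrow> L ((ops_ext P n)\<^sup>2) \<noteq> 0"
  using monic_OPS_D(3)[OF ops] by (simp add: ops_ext_def)

lemma ops_ext_orthogonal:
  assumes linear: "linear_functional L" and ops: "monic_OPS L P"
  shows "m \<noteq> n \<Longrightarrow> L (ops_ext P m * ops_ext P n) = 0"
  using monic_OPS_D(4)[OF ops, of "nat m" "nat n"]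
  by (simp add: ops_ext_def linear_functional_simps(4)[OF linear] eq_nat_nat_iff)

lemma
  assumes ops: "monic_OPS L P"
  shows degree_ops_ext: "n \<ge> 0 \<Longrightarrow> degree (ops_ext P n) = nat n"
    and lead_coeff_ops_ext: "n \<ge> 0 \<Longrightarrow> coeff (ops_ext P n) (nat n) = 1"
  using monic_OPS_D(1,2)[OF ops] by (auto simp: ops_ext_def)

lemma ops_ext_recurrence:
  assumes linear: "linear_functional L" and ops: "monic_OPS L P"
    and "n \<ge> 0"
  shows "[:0, 1:] * ops_ext P n = ops_ext P (n + 1) + smult (rec_beta L P n) (ops_ext P n)
    + smult (rec_gamma L P n) (ops_ext P (n - 1))"
  using three_term_recurrence[OF linear ops, of "nat n"] assms
  by (simp add: ops_ext_def nat_add_distrib del: mult_pCons_left)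

text \<open>Subtracting the right multiple of the n-th polynomial from \<open>f\<close> leaves a
  remainder orthogonal to it. All boundary values of \<open>A\<close> are read off through this
  lemma.\<close>

lemma linear_functional_ops_ext_mult:
  assumes linear: "linear_functional L" and ops: "monic_OPS L P"
    and "n \<ge> 0" "degree f \<le> nat n"
  shows "L (ops_ext P n * f) = coeff f (nat n) * L ((ops_ext P n)\<^sup>2)"
proof -
  note lin = linear_functional_simps[OF linear]
  let ?g = "f - smult (coeff f (nat n)) (ops_ext P n)"
  have "L (ops_ext P n * ?g) = 0"
  \<comment> \<open>For index 0 no smaller degree is available, but then \<open>f\<close> is
    constant and the remainder is zero.\<close>
  proof (cases "nat n")
    case 0
    then have "f = smult (coeff f 0) (ops_ext P n)"
      using degree_0_monic[OF ops, of f] assms by (simp add: ops_ext_def)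
    with 0 show ?thesis using lin by simp
  next
    case (Suc m)
    then show ?thesis
      using degree_diff_monic[OF ops, of f m] assms(3,4)
        ops_orthogonal_lower[OF linear ops, of ?g m "nat n"]
      by (simp add: ops_ext_def)
  qed
  then show ?thesis by (simp add: right_diff_distrib lin power2_eq_square)
qed

text \<open>The numerator defining \<open>rec_gamma L P (n + 1)\<close> pairs
  \<open>ops_ext P (n + 1)\<close> with x times \<open>ops_ext P n\<close>, which is monic of degree
  n + 1, so it equals the square norm at n + 1.\<close>

lemma square_norm_Suc:
  assumes linear: "linear_functional L" and ops: "monic_OPS L P"
    and "n \<ge> 0"
  shows "L ((ops_ext P (n + 1))\<^sup>2) = rec_gamma L P (n + 1) * L ((ops_ext P n)\<^sup>2)"
proof -
  let ?f = "[:0, 1:] * ops_ext P n"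
  have n: "n + 1 \<ge> 0" "nat (n + 1) = Suc (nat n)" using \<open>n \<ge> 0\<close> by simp_all
  have "degree ?f \<le> nat (n + 1)"
    using degree_mult_le[of "[:0, 1:]" "ops_ext P n"]
    by (simp add: n(2) degree_ops_ext[OF ops \<open>n \<ge> 0\<close>])
  then have "L (ops_ext P (n + 1) * ?f) = coeff ?f (nat (n + 1)) * L ((ops_ext P (n + 1))\<^sup>2)"
    by (rule linear_functional_ops_ext_mult[OF linear ops n(1)])
  moreover have "coeff ?f (nat (n + 1)) = 1"
    by (simp add: n(2) lead_coeff_ops_ext[OF ops \<open>n \<ge> 0\<close>])
  moreover have "rec_gamma L P (n + 1) = L (ops_ext P (n + 1) * ?f) / L ((ops_ext P n)\<^sup>2)"
    using \<open>n \<ge> 0\<close> n(2)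
    by (simp add: rec_gamma_def ops_ext_def ac_simps del: mult_pCons_left mult_pCons_right)
  ultimately show ?thesis using square_norm_nonzero[OF ops \<open>n \<ge> 0\<close>] by simp
qed

lemma square_norm_eq_prod_gamma:
  assumes linear: "linear_functional L" and ops: "monic_OPS L P"
    and "n \<ge> int r"
  shows "L ((ops_ext P n)\<^sup>2) =
    (\<Prod>j<r. rec_gamma L P (n - int j)) * L ((ops_ext P (n - int r))\<^sup>2)"
  using assms(3)
proof (induction r)
  case 0
  then show ?case by simp
next
  case (Suc r)
  have r: "n - int (Suc r) \<ge> 0" "n - int (Suc r) + 1 = n - int r" "n \<ge> int r"
    using Suc.prems by linarith+
  show ?case
    using Suc.IH[OF r(3)] square_norm_Suc[OF linear ops r(1)]
    unfolding r(2) by (simp only: prod.lessThan_Suc mult.assoc)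
qed

section \<open>Coefficients as values of the functional, and their difference equation\<close>

text \<open>Orthogonality isolates the term \<open>k = m - n\<close> of the expansion. The zero
  conventions make the formula valid for all integers m and n.\<close>

lemma linear_functional_shift_coeffs:
  assumes linear: "linear_functional L" and ops: "monic_OPS L P"
    and "shift_coeffs lam P A"
  shows "L (lam * pcompose (ops_ext P n) [:1, 1:] * ops_ext P m) =
    A (m - n) n * L ((ops_ext P m)\<^sup>2)"
proof (cases "n \<ge> 0")
  case False
  then have "A (m - n) n = 0" using assms by (simp add: shift_coeffs_def)
  then show ?thesis using False linear_functional_simps[OF linear] by simp
next
  case True
  let ?K = "{k. A k n \<noteq> 0}"
  have fin: "finite ?K"
    and eq: "lam * pcompose (ops_ext P n) [:1, 1:] =
      (\<Sum>k\<in>?K. smult (A k n) (ops_ext P (n + k)))"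
    using assms(3) True unfolding shift_coeffs_def by blast+
  have "L (lam * pcompose (ops_ext P n) [:1, 1:] * ops_ext P m) =
      (\<Sum>k\<in>?K. A k n * L (ops_ext P (n + k) * ops_ext P m))"
    by (simp add: eq sum_distrib_right linear_functional_sum[OF linear]
        linear_functional_simps(3)[OF linear])
  also have "\<dots> = (\<Sum>k\<in>?K. if k = m - n then A (m - n) n * L ((ops_ext P m)\<^sup>2) else 0)"
    by (intro sum.cong refl) (auto simp: power2_eq_square ops_ext_orthogonal[OF linear ops])
  \<comment> \<open>If \<open>m - n\<close> lies outside the support \<open>?K\<close>, the sum is
    zero, and so is \<open>A (m - n) n\<close>.\<close>
  also have "\<dots> = A (m - n) n * L ((ops_ext P m)\<^sup>2)"
    using fin by simp
  finally show ?thesis .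
qed

lemma shift_coeffs_difference_equation:
  assumes linear: "linear_functional L" and ops: "monic_OPS L P"
    and A: "shift_coeffs lam P A" and "n \<ge> 0"
  shows "rec_gamma L P (n + k + 1) * A (k + 1) n - rec_gamma L P n * A (k + 1) (n - 1)
      + A (k - 1) n - A (k - 1) (n + 1)
    = (rec_beta L P n - rec_beta L P (n + k) - 1) * A k n"
proof -
  note lin = linear_functional_simps[OF linear]
  have A0: "A j i = 0" if "i < 0 \<or> i + j < 0" for i j
    using A that unfolding shift_coeffs_def by blast
  define m where "m = n + k"
  \<comment> \<open>For \<open>m < -1\<close> every coefficient in the equation vanishes. For
    \<open>m = -1\<close> only \<open>A (k + 1) n\<close> may survive, and its factor is the gamma
    of index 0, which is zero.\<close>
  consider "m < -1" | "m = -1" | "m \<ge> 0" by linarith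
  then show ?thesis
  proof cases
    case 3
    let ?S = "\<lambda>i. lam * pcompose (ops_ext P i) [:1, 1:]"
    let ?X = "[:0, 1:] :: complex poly"
    have c: "L (?S i * ops_ext P j) = A (j - i) i * L ((ops_ext P j)\<^sup>2)" for i j
      by (rule linear_functional_shift_coeffs[OF linear ops A])
    have "L (?S n * (?X * ops_ext P m)) =
        L (?S n * ops_ext P (m + 1)) + rec_beta L P m * L (?S n * ops_ext P m)
          + rec_gamma L P m * L (?S n * ops_ext P (m - 1))"
      by (simp only: ops_ext_recurrence[OF linear ops 3] distrib_left mult_smult_right lin)
    also have "\<dots> =
        (rec_gamma L P (m + 1) * A (k + 1) n + rec_beta L P m * A k n + A (k - 1) n)
          * L ((ops_ext P m)\<^sup>2)"
    proof -
      \<comment> \<open>Every term is to become a multiple of the square norm at m. At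
        \<open>m = 0\<close> the norm at \<open>m - 1\<close> is zero and the reduction fails, but
        there \<open>A (k - 1) n\<close> belongs to index -1 and vanishes.\<close>
      have "rec_gamma L P m * (A (k - 1) n * L ((ops_ext P (m - 1))\<^sup>2)) =
          A (k - 1) n * L ((ops_ext P m)\<^sup>2)"
      proof (cases "m = 0")
        case True
        then have "A (k - 1) n = 0" using A0[of n "k - 1"] m_def by linarith
        then show ?thesis by simp
      next
        case False
        then have "m - 1 \<ge> 0" using 3 by linarith
        then show ?thesis using square_norm_Suc[OF linear ops, of "m - 1"] by simp
      qed
      then show ?thesis
        unfolding c square_norm_Suc[OF linear ops 3] by (simp add: m_def algebra_simps)
    qed
    finally have 1: "L (?S n * (?X * ops_ext P m)) = \<dots>" .
    \<comment> \<open>The recurrence is shifted to x + 1; writing x = (x + 1) - 1 produces the -1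
      beside \<open>rec_beta L P n\<close>.\<close>
    have "pcompose (?X * ops_ext P n) [:1, 1:] = (?X + 1) * pcompose (ops_ext P n) [:1, 1:]"
      by (simp only: pcompose_mult) (simp add: pcompose_pCons one_pCons)
    then have "?X * pcompose (ops_ext P n) [:1, 1:] =
        pcompose (?X * ops_ext P n) [:1, 1:] - pcompose (ops_ext P n) [:1, 1:]"
      by (simp only: distrib_right) simp
    also have "\<dots> = pcompose (ops_ext P (n + 1)) [:1, 1:]
        + smult (rec_beta L P n - 1) (pcompose (ops_ext P n) [:1, 1:])
        + smult (rec_gamma L P n) (pcompose (ops_ext P (n - 1)) [:1, 1:])"
      by (simp only: ops_ext_recurrence[OF linear ops \<open>n \<ge> 0\<close>] pcompose_add pcompose_smult)
        (simp add: smult_diff_left)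
    finally have X: "?X * pcompose (ops_ext P n) [:1, 1:] = \<dots>" .
    have "L (?S n * (?X * ops_ext P m)) =
        L (lam * (?X * pcompose (ops_ext P n) [:1, 1:]) * ops_ext P m)"
      by (simp only: ac_simps)
    also have "\<dots> = L (?S (n + 1) * ops_ext P m) + (rec_beta L P n - 1) * L (?S n * ops_ext P m)
        + rec_gamma L P n * L (?S (n - 1) * ops_ext P m)"
      by (simp only: X distrib_left distrib_right mult_smult_right mult_smult_left lin)
    also have "\<dots> =
        (A (k - 1) (n + 1) + (rec_beta L P n - 1) * A k n + rec_gamma L P n * A (k + 1) (n - 1))
          * L ((ops_ext P m)\<^sup>2)"
      unfolding c by (simp add: m_def algebra_simps)
    finally have "rec_gamma L P (m + 1) * A (k + 1) n + rec_beta L P m * A k n + A (k - 1) n =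
        A (k - 1) (n + 1) + (rec_beta L P n - 1) * A k n + rec_gamma L P n * A (k + 1) (n - 1)"
      using 1 square_norm_nonzero[OF ops 3] by simp
    then show ?thesis by (simp add: m_def algebra_simps)
  qed (auto simp: m_def A0 rec_gamma_def)
qed

section \<open>Boundary values of the coefficients\<close>

text \<open>Since the shifted polynomial \<open>?S\<close> is monic of degree n,
  \<open>lam * ?S\<close> has degree at most n + k, and its coefficient there is that of
  \<open>lam\<close> at k.\<close>

lemma shift_coeffs_upper:
  assumes linear: "linear_functional L" and ops: "monic_OPS L P"
    and A: "shift_coeffs lam P A" and lam: "degree lam \<le> nat k" and "n \<ge> 0" "k \<ge> 0"
  shows "A k n = coeff lam (nat k)"
proof -
  let ?S = "pcompose (ops_ext P n) [:1, 1:]"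
  have S: "degree ?S = nat n" "coeff ?S (nat n) = 1"
    using coeff_pcompose_shift_degree[of "ops_ext P n" 1] \<open>n \<ge> 0\<close>
    by (simp_all add: degree_pcompose degree_ops_ext[OF ops] lead_coeff_ops_ext[OF ops])
  have k: "n + k \<ge> 0" "nat (n + k) = nat k + nat n"
    using \<open>n \<ge> 0\<close> \<open>k \<ge> 0\<close> by (simp_all add: nat_add_distrib add.commute)
  have "A k n * L ((ops_ext P (n + k))\<^sup>2) = L (ops_ext P (n + k) * (lam * ?S))"
    using linear_functional_shift_coeffs[OF linear ops A, of n "n + k"] by (simp add: mult.commute)
  also have "\<dots> = coeff (lam * ?S) (nat (n + k)) * L ((ops_ext P (n + k))\<^sup>2)"
  proof (rule linear_functional_ops_ext_mult[OF linear ops k(1)])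
    show "degree (lam * ?S) \<le> nat (n + k)"
      unfolding k(2) using lam S(1) by (intro order_trans[OF degree_mult_le] add_mono) simp_all
  qed
  also have "\<dots> = coeff lam (nat k) * L ((ops_ext P (n + k))\<^sup>2)"
    unfolding k(2) using coeff_mult_degree_le[OF lam eq_refl[OF S(1)]] S(2) by simp
  finally show ?thesis using square_norm_nonzero[OF ops k(1)] by simp
qed

text \<open>With \<open>m = n - int r\<close>, the Pearson equation frees the n-th polynomial from
  its shift, and its cofactor has degree at most n. The quotient of the square norms at n and m is
  the product of gammas.\<close>

lemma shift_coeffs_lower:
  assumes linear: "linear_functional L" and ops: "monic_OPS L P"
    and A: "shift_coeffs lam P A"
    and pearson: "\<And>r. L (lam * r) = L (phi * pcompose r [:-1, 1:])"
    and phi: "degree phi \<le> r" and "n \<ge> 0"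
  shows "A (- int r) n = coeff phi r * (\<Prod>j<r. rec_gamma L P (n - int j))"
proof (cases "n \<ge> int r")
  case False
  \<comment> \<open>The factor at \<open>j = nat n\<close> is the gamma of index 0.\<close>
  then have "(\<Prod>j<r. rec_gamma L P (n - int j)) = 0"
    using \<open>n \<ge> 0\<close> by (intro prod_zero bexI[of _ "nat n"]) (auto simp: rec_gamma_def)
  moreover have "A (- int r) n = 0" using A False by (simp add: shift_coeffs_def)
  ultimately show ?thesis by simp
next
  case True
  define m where "m = n - int r"
  let ?T = "pcompose (ops_ext P m) [:-1, 1:]"
  have m: "m \<ge> 0" "nat n = r + nat m" using True by (simp_all add: m_def nat_diff_distrib)
  have T: "degree ?T = nat m" "coeff ?T (nat m) = 1"
    using coeff_pcompose_shift_degree[of "ops_ext P m" "-1"] m(1)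
    by (simp_all add: degree_pcompose degree_ops_ext[OF ops] lead_coeff_ops_ext[OF ops])
  have "A (- int r) n * L ((ops_ext P m)\<^sup>2) =
      L (lam * (pcompose (ops_ext P n) [:1, 1:] * ops_ext P m))"
    using linear_functional_shift_coeffs[OF linear ops A, of n m] by (simp add: m_def mult.assoc)
  \<comment> \<open>The substitution of x - 1 undoes the shift in the first factor and moves it to
    the second.\<close>
  also have "\<dots> = L (ops_ext P n * (phi * ?T))"
    by (simp only: pearson pcompose_mult pcompose_shift_inverse mult.left_commute)
  also have "\<dots> = coeff (phi * ?T) (nat n) * L ((ops_ext P n)\<^sup>2)"
  proof (rule linear_functional_ops_ext_mult[OF linear ops \<open>n \<ge> 0\<close>])
    show "degree (phi * ?T) \<le> nat n"
      unfolding m(2) using phi T(1) by (intro order_trans[OF degree_mult_le] add_mono) simp_all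
  qed
  also have "\<dots> = coeff phi r * L ((ops_ext P n)\<^sup>2)"
    unfolding m(2) using coeff_mult_degree_le[OF phi eq_refl[OF T(1)]] T(2) by simp
  also have "\<dots> = coeff phi r * (\<Prod>j<r. rec_gamma L P (n - int j)) * L ((ops_ext P m)\<^sup>2)"
    using square_norm_eq_prod_gamma[OF linear ops True] by (simp add: m_def)
  finally show ?thesis using square_norm_nonzero[OF ops m(1)] by simp
qed

theorem theorem3:
  fixes p q :: nat
    and z :: complex
    and a b :: "nat \<Rightarrow> complex"
    and L :: "complex poly \<Rightarrow> complex"
    and P :: "nat \<Rightarrow> complex poly"
    and A :: "int \<Rightarrow> int \<Rightarrow> complex"
  assumes "linear_functional L"
    and "\<And>r. L (pearson_lambda z p a * r) = L (pearson_phi q b * pcompose r [:-1, 1:])"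
    and "monic_OPS L P"
    and "shift_coeffs (pearson_lambda z p a) P A"
  shows "(\<forall>n::int. \<forall>k::int. n \<ge> 0 \<and> - int q - 1 \<le> k \<and> k \<le> int p \<longrightarrow>
            rec_gamma L P (n + k + 1) * A (k + 1) n - rec_gamma L P n * A (k + 1) (n - 1)
              + A (k - 1) n - A (k - 1) (n + 1)
            = (rec_beta L P n - rec_beta L P (n + k) - 1) * A k n) \<and>
         (\<forall>n::int. n \<ge> 0 \<longrightarrow>
            A (int p) n = z \<and>
            A (- int q - 1) n = (\<Prod>j=0..q. rec_gamma L P (n - int j)) \<and>
            A (int p + 1) n = 0 \<and>
            A (- int q - 2) n = 0)"
proof (intro conjI allI impI)
  fix n k :: int
  assume "n \<ge> 0 \<and> - int q - 1 \<le> k \<and> k \<le> int p"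
  then have "n \<ge> 0" by (rule conjunct1)
  then show "rec_gamma L P (n + k + 1) * A (k + 1) n - rec_gamma L P n * A (k + 1) (n - 1)
      + A (k - 1) n - A (k - 1) (n + 1) = (rec_beta L P n - rec_beta L P (n + k) - 1) * A k n"
    by (rule shift_coeffs_difference_equation[OF assms(1,3,4)])
next
  fix n :: int
  assume n: "n \<ge> 0"
  have "A (int p) n = coeff (pearson_lambda z p a) (nat (int p))"
    by (rule shift_coeffs_upper[OF assms(1,3,4) _ n]) (simp_all add: degree_pearson_lambda)
  then show "A (int p) n = z" by (simp only: nat_int coeff_pearson_lambda)
next
  fix n :: int
  assume n: "n \<ge> 0"
  have p: "degree (pearson_lambda z p a) < nat (int p + 1)"
    using degree_pearson_lambda[of z p a] by simp
  have "A (int p + 1) n = coeff (pearson_lambda z p a) (nat (int p + 1))"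
    by (rule shift_coeffs_upper[OF assms(1,3,4) less_imp_le[OF p] n]) simp
  then show "A (int p + 1) n = 0" by (simp only: coeff_eq_0[OF p])
next
  fix n :: int
  assume n: "n \<ge> 0"
  \<comment> \<open>The lower edge is \<open>r = Suc q\<close>, where \<open>pearson_phi q b\<close>
    has coefficient 1; one index further, at \<open>r = q + 2\<close>, its coefficient is 0.\<close>
  have idx: "- int q - 1 = - int (Suc q)" by simp
  show "A (- int q - 1) n = (\<Prod>j=0..q. rec_gamma L P (n - int j))"
    unfolding idx shift_coeffs_lower[OF assms(1,3,4,2) degree_pearson_phi n]
    by (simp add: coeff_pearson_phi atMost_atLeast0 lessThan_Suc_atMost)
next
  fix n :: int
  assume n: "n \<ge> 0"
  have idx: "- int q - 2 = - int (q + 2)" by simp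
  have phi: "degree (pearson_phi q b) < q + 2"
    by (rule le_less_trans[OF degree_pearson_phi]) simp
  show "A (- int q - 2) n = 0"
    unfolding idx shift_coeffs_lower[OF assms(1,3,4,2) less_imp_le[OF phi] n]
    using phi by (simp add: coeff_eq_0)
qed

end
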